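(* Suppose that $\sum_{i=1}^n W_i = \sum_{i=1}^n (1-W_i)$ (the treatment and control groups have equal size $n/2$) and that $\varphi(\mathbf{x},\mathbf{W}) = \varphi(\mathbf{x},\mathbf{1}-\mathbf{W})$ for every assignment vector $\mathbf{W}$. Then $$\mathbb{E}(\hat{\tau} \mid \mathbf{x}, \varphi = 1) = \tau ,$$ i.e. after rerandomization with criterion $\varphi$ the difference in observed sample means is an unbiased estimate of the average treatment effect.
   Context: There are $n$ experimental units, and $\mathbf{x}$ is a fixed $n\times k$ covariate matrix. The treatment assignment vector $\mathbf{W}=(W_1,\dots,W_n)\in\{0,1\}^n$ has $W_i=1$ if unit $i$ is treated and $W_i=0$ if unit $i$ is control; $\mathbf{1}$ is the all-ones vector. Each unit $i$ has two fixed potential outcomes $y_i(1),y_i(0)\in\mathbb{R}$, which do not change with the assignment vector (Stable Unit Treatment Value Assumption). The observed outcome is $Y_{obs,i}=y_i(1)W_i+y_i(0)(1-W_i)$. The average treatment effect is $\tau=\frac1n\sum_{i=1}^n y_i(1)-\frac1n\sum_{i=1}^n y_i(0)$, and its estimate is $$\hat\tau=\frac{\sum_{i=1}^n W_i\,y_i(1)}{\sum_{i=1}^n W_i}-\frac{\sum_{i=1}^n (1-W_i)\,y_i(0)}{\sum_{i=1}^n(1-W_i)}.$$ A rerandomization criterion is a function $\varphi(\mathbf{x},\mathbf{W})\in\{0,1\}$, specified in advance; $\mathbf{W}$ is acceptable if $\varphi(\mathbf{x},\mathbf{W})=1$. Rerandomization draws $\mathbf{W}$ at random from all assignment vectors with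 the given group sizes (uniformly), and redraws until an acceptable $\mathbf{W}$ is obtained. Thus $\mathbb{E}(\cdot\mid\mathbf{x},\varphi=1)$ is the expectation over $\mathbf{W}$ uniformly distributed on assignment vectors with the given group sizes, conditional on $\varphi(\mathbf{x},\mathbf{W})=1$; at least one acceptable assignment is assumed to exist. *)

theory Defs
  imports "HOL-Probability.Probability"
begin

text \<open>
  Units are the elements of the finite index type \<open>'n\<close>.  Assignments are real vectors with entries \<open>0\<close> and \<open>1\<close>;
  since \<open>1\<close> is the all-ones vector, \<open>1 - W\<close> swaps treatment and control.
\<close>

definition assignment_vectors :: "(real ^ 'n) set" where
  "assignment_vectors = {W. \<forall>i. W $ i \<in> {0, 1}}"

definition assignments :: "nat \<Rightarrow> nat \<Rightarrow> (real ^ 'n) set" where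
  "assignments nT nC = {W \<in> assignment_vectors.
     (\<Sum>i\<in>UNIV. W $ i) = real nT \<and> (\<Sum>i\<in>UNIV. 1 - W $ i) = real nC}"

definition ATE :: "real ^ 'n \<Rightarrow> real ^ 'n \<Rightarrow> real" where
  "ATE y1 y0 = 1 / real CARD('n) * (\<Sum>i\<in>UNIV. y1 $ i) - 1 / real CARD('n) * (\<Sum>i\<in>UNIV. y0 $ i)"

definition ATE_hat :: "real ^ 'n \<Rightarrow> real ^ 'n \<Rightarrow> real ^ 'n \<Rightarrow> real" where
  "ATE_hat y1 y0 W =
     (\<Sum>i\<in>UNIV. W $ i * y1 $ i) / (\<Sum>i\<in>UNIV. W $ i)
     - (\<Sum>i\<in>UNIV. (1 - W $ i) * y0 $ i) / (\<Sum>i\<in>UNIV. 1 - W $ i)"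

definition Y_obs :: "real ^ 'n \<Rightarrow> real ^ 'n \<Rightarrow> real ^ 'n \<Rightarrow> real ^ 'n" where
  "Y_obs y1 y0 W = (\<chi> i. y1 $ i * W $ i + y0 $ i * (1 - W $ i))"

lemma ATE_hat_eq_observed:
  fixes y1 y0 W :: "real ^ 'n"
  assumes "W \<in> assignment_vectors"
  shows "ATE_hat y1 y0 W =
     (\<Sum>i\<in>UNIV. W $ i * Y_obs y1 y0 W $ i) / (\<Sum>i\<in>UNIV. W $ i)
     - (\<Sum>i\<in>UNIV. (1 - W $ i) * Y_obs y1 y0 W $ i) / (\<Sum>i\<in>UNIV. 1 - W $ i)"
proof -
  have "W $ i * Y_obs y1 y0 W $ i = W $ i * y1 $ i"
    and "(1 - W $ i) * Y_obs y1 y0 W $ i = (1 - W $ i) * y0 $ i" for i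
  proof -
    have "W $ i = 0 \<or> W $ i = 1"
      using assms by (auto simp: assignment_vectors_def)
    then show "W $ i * Y_obs y1 y0 W $ i = W $ i * y1 $ i"
      and "(1 - W $ i) * Y_obs y1 y0 W $ i = (1 - W $ i) * y0 $ i"
      by (auto simp: Y_obs_def)
  qed
  then show ?thesis by (simp only: ATE_hat_def)
qed

text \<open>
  Redrawing a uniform assignment until it is acceptable amounts to conditioning the uniform
  distribution on acceptance.  Since \<open>pmf_of_set\<close> and \<open>cond_pmf\<close> are unspecified for an empty set and
  a null event, this is meaningful only if some assignment with the given group sizes is acceptable.
\<close>

definition rerandomized ::
    "(real ^ 'k ^ 'n \<Rightarrow> real ^ 'n \<Rightarrow> nat) \<Rightarrow> real ^ 'k ^ 'n \<Rightarrow> nat \<Rightarrow> nat \<Rightarrow> (real ^ 'n) pmf" where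
  "rerandomized \<phi> x nT nC = cond_pmf (pmf_of_set (assignments nT nC)) {W. \<phi> x W = 1}"

end

theory Submission
  imports Defs
begin

text \<open>
  Swapping treatment and control is an involution of the acceptable assignments, and for groups of
  equal size the estimates at \<open>W\<close> and \<open>1 - W\<close> average to exactly the treatment effect.
\<close>

text \<open>A 0/1 vector is determined by the set of its treated units, so these vectors embed into
  the finite power set of \<open>'n\<close>.\<close>

lemma finite_assignment_vectors: "finite (assignment_vectors :: (real ^ 'n) set)"
proof (rule finite_imageD)
  show "inj_on (\<lambda>W :: real ^ 'n. {i. W $ i = 1}) assignment_vectors"
  proof (rule inj_onI)
    fix V W :: "real ^ 'n"
    assume "V \<in> assignment_vectors" "W \<in> assignment_vectors"
      and eq: "{i. V $ i = 1} = {i. W $ i = 1}"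
    then have "V $ i \<in> {0, 1}" "W $ i \<in> {0, 1}" "V $ i = 1 \<longleftrightarrow> W $ i = 1" for i
      by (auto simp: assignment_vectors_def)
    then have "V $ i = W $ i" for i
      by (metis empty_iff insert_iff)
    then show "V = W"
      by (simp add: vec_eq_iff)
  qed
qed simp

lemma finite_assignments: "finite (assignments nT nC :: (real ^ 'n) set)"
  by (rule finite_subset[OF _ finite_assignment_vectors]) (auto simp: assignments_def)

lemma assignments_swap: "W \<in> assignments nT nC \<Longrightarrow> 1 - W \<in> assignments nC nT"
  by (auto simp: assignments_def assignment_vectors_def)

text \<open>Each unit is treated in exactly one of \<open>W\<close> and \<open>1 - W\<close>, and
  all denominators equal \<open>m\<close>. The partial sums therefore combine to full sums of
  \<open>y1\<close> and \<open>y0\<close> divided by \<open>m\<close>, which is half the number of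
  units.\<close>

lemma ATE_hat_add_swap:
  fixes y1 y0 W :: "real ^ 'n"
  assumes "W \<in> assignments m m"
  shows "ATE_hat y1 y0 W + ATE_hat y1 y0 (1 - W) = 2 * ATE y1 y0"
proof -
  have sizes: "(\<Sum>i\<in>UNIV. W $ i) = real m" "(\<Sum>i\<in>UNIV. 1 - W $ i) = real m"
    using assms by (auto simp: assignments_def)
  \<comment> \<open>Adding the two group sizes counts every unit once.\<close>
  then have "(\<Sum>i\<in>(UNIV :: 'n set). 1) = 2 * real m"
    by (simp add: sum_subtractf)
  then have n: "real CARD('n) = 2 * real m"
    by simp
  have split: "(\<Sum>i\<in>UNIV. y $ i) = (\<Sum>i\<in>UNIV. W $ i * y $ i) + (\<Sum>i\<in>UNIV. (1 - W $ i) * y $ i)"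
    for y :: "real ^ 'n"
    unfolding sum.distrib[symmetric] by (simp add: algebra_simps)
  show ?thesis
    unfolding ATE_hat_def ATE_def n split[of y1] split[of y0]
    by (simp add: sizes diff_divide_distrib add_divide_distrib)
qed

text \<open>Each point of \<open>S \<inter> T\<close> has mass \<open>1 / card S\<close>, and
  conditioning divides it by \<open>card (S \<inter> T) / card S\<close>; the factor
  \<open>card S\<close> cancels.\<close>

lemma cond_pmf_of_set:
  assumes "finite S" "S \<inter> T \<noteq> {}"
  shows "cond_pmf (pmf_of_set S) T = pmf_of_set (S \<inter> T)"
proof (rule pmf_eqI)
  fix a
  have "S \<noteq> {}"
    using assms(2) by auto
  then have S: "S \<noteq> {}" "set_pmf (pmf_of_set S) \<inter> T \<noteq> {}"
    using assms by simp_all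
  have "card S > 0"
    using assms(1) S(1) by (simp add: card_gt_0_iff)
  then show "pmf (cond_pmf (pmf_of_set S) T) a = pmf (pmf_of_set (S \<inter> T)) a"
    using assms S by (simp add: pmf_cond measure_pmf_of_set indicator_def)
qed

text \<open>Removes probability from the argument: what remains is a finite average over the
  acceptable assignments.\<close>

lemma expectation_rerandomized:
  fixes f :: "real ^ 'n \<Rightarrow> real"
  assumes "\<exists>W \<in> assignments nT nC. \<phi> x W = 1"
  defines "A \<equiv> {W \<in> assignments nT nC. \<phi> x W = 1}"
  shows "measure_pmf.expectation (rerandomized \<phi> x nT nC) f = sum f A / real (card A)"
proof -
  have A: "A = assignments nT nC \<inter> {W. \<phi> x W = 1}" "A \<noteq> {}" "finite A"
    using assms(1) finite_assignments[of nT nC] by (auto simp: A_def)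
  have "rerandomized \<phi> x nT nC = pmf_of_set A"
    unfolding rerandomized_def A(1)
    using A(1,2) by (intro cond_pmf_of_set finite_assignments) auto
  with A(2,3) show ?thesis
    by (simp add: integral_pmf_of_set)
qed

theorem theorem2p1:
  fixes x :: "real ^ 'k ^ 'n"
    and \<phi> :: "real ^ 'k ^ 'n \<Rightarrow> real ^ 'n \<Rightarrow> nat"
    and y1 y0 :: "real ^ 'n"
    and nT nC :: nat
  assumes criterion: "\<And>x' W. W \<in> assignment_vectors \<Longrightarrow> \<phi> x' W \<in> {0, 1}"
    and acceptable: "\<exists>W \<in> assignments nT nC. \<phi> x W = 1"
    and equal_sizes: "nT = nC"
    and symmetric: "\<And>W. W \<in> assignment_vectors \<Longrightarrow> \<phi> x W = \<phi> x (1 - W)"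
  shows "measure_pmf.expectation (rerandomized \<phi> x nT nC) (ATE_hat y1 y0) = ATE y1 y0"
proof -
  define A where "A = {W \<in> assignments nT nC. \<phi> x W = 1}"
  \<comment> \<open>Equal sizes keep \<open>1 - W\<close> among the assignments; the symmetry of
    \<open>\<phi>\<close> keeps it acceptable.\<close>
  have swap: "1 - W \<in> A" if "W \<in> A" for W
  proof -
    have "W \<in> assignment_vectors" "\<phi> x W = 1" "W \<in> assignments nT nC"
      using that by (auto simp: A_def assignments_def)
    then show ?thesis
      using symmetric[of W] assignments_swap[of W nT nC] equal_sizes by (simp add: A_def)
  qed
  \<comment> \<open>The swap is its own inverse, so it serves as both maps of the bijection of
    \<open>A\<close>.\<close>
  have "sum (ATE_hat y1 y0) A = (\<Sum>W\<in>A. ATE_hat y1 y0 (1 - W))"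
    by (rule sum.reindex_bij_witness[of _ "\<lambda>W. 1 - W" "\<lambda>W. 1 - W"]) (auto intro: swap)
  then have "2 * sum (ATE_hat y1 y0) A = (\<Sum>W\<in>A. ATE_hat y1 y0 W + ATE_hat y1 y0 (1 - W))"
    by (simp add: sum.distrib)
  also have "\<dots> = (\<Sum>W\<in>A. 2 * ATE y1 y0)"
    by (rule sum.cong) (auto simp: A_def equal_sizes intro: ATE_hat_add_swap)
  finally have "sum (ATE_hat y1 y0) A = real (card A) * ATE y1 y0"
    by simp
  \<comment> \<open>Needed to divide by the number of acceptable assignments.\<close>
  moreover have "card A > 0"
    using acceptable finite_assignments[of nT nC] by (auto simp: A_def card_gt_0_iff)
  ultimately show ?thesis
    using expectation_rerandomized[where \<phi> = \<phi>, OF acceptable] by (simp add: A_def)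
qed

end
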